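(* Let $\operatorname{opt}_{\mathcal{M}}$ denote the E-admissibility choice function induced by the credal set $\mathcal{M}$. For any consistent decision tree $T$, $$\operatorname{back}_{\operatorname{opt}_{\mathcal{M}}}(T)=\operatorname{norm}_{\operatorname{opt}_{\mathcal{M}}}(T).$$
   Context: **Uncertainty model.** $\Omega$ is a finite non-empty set (possibility space); events are subsets of $\Omega$, and $\overline{A}$ is the complement of $A$. A gamble is a function $X\colon\Omega\to\mathbb{R}$. An event also denotes its indicator, so $AX$ means $I_A X$. $\mathcal{M}$ is a (non-empty) closed convex set of probability mass functions on $\Omega$ with $p(\omega)>0$ for all $p\in\mathcal{M}$, $\omega\in\Omega$. For a non-empty event $A$ and $p\in\mathcal{M}$, $E_p(X|A)=\frac{\sum_{\omega\in A}X(\omega)p(\omega)}{\sum_{\omega\in A}p(\omega)}$. **Choice functions.** A choice function $\operatorname{opt}$ maps, for each non-empty event $A$, each non-empty finite set $\mathcal{X}$ of gambles to a non-empty subset $\operatorname{opt}(\mathcal{X}|A)\subseteq\mathcal{X}$. For $p\in\mathcal{M}$ let $\operatorname{opt}_p(\mathcal{X}|A)=\{X\in\mathcal{X}\colon(\forall Y\in\mathcal{X})(E_p(Y|A)\leq E_p(X|A))\}$. E-admissibility is $\operatorname{opt}_{\mathcal{M}}(\mathcal{X}|A)=\bigcup_{p\in\mathcal{M}}\operatorname{opt}_p(\mathcal{X}|A)$. **Decision trees.** A decision tree is a finite rooted tree whose nodes are reward leaves (labelled by real numbers), decision nodes, and chance nodes; the arcs leaving a chance node are labelled by events forming a partition of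 $\Omega$. With every tree $T$ is associated an event $\operatorname{ev}(T)$, the intersection of all events on chance arcs that precede $T$. For a node $N$ of $T$, $\operatorname{st}_N(T)$ denotes the subtree of $T$ at $N$ (all non-descendants of $N$ removed); $\operatorname{ev}(\operatorname{st}_N(T))$ is the intersection of $\operatorname{ev}(T)$ with all events on the chance arcs on the path from the root of $T$ to $N$. $T$ is consistent if $\operatorname{ev}(\operatorname{st}_N(T))\neq\emptyset$ for every node $N$ of $T$. **Normal form decisions and gambles.** A normal form decision of $T$ is a reduced tree obtained from $T$ by keeping exactly one arc at each decision node (and discarding the parts no longer reachable); it has the same associated event $\operatorname{ev}(T)$. $\operatorname{nfd}(T)$ is the set of all of them. Each normal form decision $U$ has a gamble: a leaf with reward $r$ gives the constant gamble $r$; a decision node gives the gamble of its single remaining subtree; a chance node with events $E_1,\dots,E_n$ whose subtrees have gambles $X_1,\dots,X_n$ gives $\sum_{i=1}^n E_iX_i$. For $U\in\operatorname{nfd}(T)$, $\operatorname{gamb}(U)$ is the singleton containing its gamble; for a set $\mathcal{U}$ of normal form decisions $\operatorname{gamb}(\mathcal{U})=\bigcup_{U\in\mathcal{U}}\operatorname{gamb}(U)$; and $\operatorname{gamb}(T)=\operatorname{gamb}(\operatorname{nfd}(T))$. **The two solution operators.** For a choice function $\operatorname{opt}$ and a consistent tree $T$, $$\operatorname{norm}_{\operatorname{opt}}(T)=\{U\in\operatorname{nfd}(T)\colon\operatorname{gamb}(U)\subseteq\operatorname{opt}(\operatorname{gamb}(T)|\operatorname{ev}(T))\}.$$ The normal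 form backward induction operator $\operatorname{back}_{\operatorname{opt}}$ is defined recursively from right to left: if $T$ is a reward leaf, $\operatorname{back}_{\operatorname{opt}}(T)=\{T\}$. Otherwise, let $S(T)$ be the set of those $U\in\operatorname{nfd}(T)$ such that, for each child subtree $T_i$ of the root of $T$ that is retained in $U$ (all children if the root is a chance node, the chosen child if it is a decision node), the restriction of $U$ to $T_i$ belongs to $\operatorname{back}_{\operatorname{opt}}(T_i)$, where $T_i$ carries its event $\operatorname{ev}(T_i)$ as a subtree of $T$; then $$\operatorname{back}_{\operatorname{opt}}(T)=\{U\in S(T)\colon\operatorname{gamb}(U)\subseteq\operatorname{opt}(\operatorname{gamb}(S(T))|\operatorname{ev}(T))\}.$$ *)

theory Defs
  imports "HOL-Analysis.Analysis"
begin

text \<open>The possibility space is the whole of a finite type \<open>'w\<close>; the complement of an event, the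
  indicator of an event and the like are then the usual operations on sets over that type.\<close>

type_synonym 'w event = "'w set"
type_synonym 'w gamble = "'w \<Rightarrow> real"

text \<open>Mass functions are vectors, so that \<open>closed\<close> and \<open>convex\<close> are those of Euclidean space.\<close>

definition credal_set :: "(real ^ 'w::finite) set \<Rightarrow> bool" where
  "credal_set M \<longleftrightarrow> M \<noteq> {} \<and> closed M \<and> convex M \<and>
     (\<forall>p\<in>M. (\<forall>\<omega>. p $ \<omega> > 0) \<and> (\<Sum>\<omega>\<in>UNIV. p $ \<omega>) = 1)"

definition cond_exp :: "real ^ 'w::finite \<Rightarrow> 'w gamble \<Rightarrow> 'w event \<Rightarrow> real" where
  "cond_exp p X A = (\<Sum>\<omega>\<in>A. X \<omega> * p $ \<omega>) / (\<Sum>\<omega>\<in>A. p $ \<omega>)"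

text \<open>\<open>opt \<X> A\<close> stands for $\mathrm{opt}(\mathcal{X}|A)$; its value matters only for non-empty
  finite \<open>\<X>\<close> and non-empty \<open>A\<close>.\<close>

type_synonym 'w choice = "'w gamble set \<Rightarrow> 'w event \<Rightarrow> 'w gamble set"

definition is_choice_function :: "'w choice \<Rightarrow> bool" where
  "is_choice_function opt \<longleftrightarrow>
     (\<forall>\<X> A. A \<noteq> {} \<longrightarrow> finite \<X> \<longrightarrow> \<X> \<noteq> {} \<longrightarrow> opt \<X> A \<noteq> {} \<and> opt \<X> A \<subseteq> \<X>)"

definition opt_mass :: "real ^ 'w::finite \<Rightarrow> 'w choice" where
  "opt_mass p \<X> A = {X \<in> \<X>. \<forall>Y\<in>\<X>. cond_exp p Y A \<le> cond_exp p X A}"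

definition e_admissible :: "(real ^ 'w::finite) set \<Rightarrow> 'w choice" where
  "e_admissible M \<X> A = (\<Union>p\<in>M. opt_mass p \<X> A)"

lemma e_admissible_is_choice_function:
  assumes "credal_set M"
  shows "is_choice_function (e_admissible M)"
  unfolding is_choice_function_def
proof (intro allI impI conjI)
  fix \<X> :: "'a gamble set" and A :: "'a event"
  assume fin: "finite \<X>" and ne: "\<X> \<noteq> {}"
  obtain p where p: "p \<in> M"
    using assms by (auto simp: credal_set_def)
  let ?f = "\<lambda>X. cond_exp p X A"
  have "Max (?f ` \<X>) \<in> ?f ` \<X>"
    using fin ne by (intro Max_in) auto
  then obtain X where X: "X \<in> \<X>" and max: "?f X = Max (?f ` \<X>)"
    by force
  have "?f Y \<le> ?f X" if "Y \<in> \<X>" for Y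
    unfolding max using that fin by (intro Max_ge) auto
  with X p show "e_admissible M \<X> A \<noteq> {}"
    by (auto simp: e_admissible_def opt_mass_def)
  show "e_admissible M \<X> A \<subseteq> \<X>"
    by (auto simp: e_admissible_def opt_mass_def)
qed

text \<open>The arcs leaving a decision node carry names, distinct at each node, so that a reduced tree
  records which arc was kept even when two arcs lead to identical subtrees.\<close>

datatype ('w, 'd) dtree =
    Leaf real
  | Decision "('d \<times> ('w, 'd) dtree) list"
  | Chance "('w event \<times> ('w, 'd) dtree) list"

fun wf_tree :: "('w, 'd) dtree \<Rightarrow> bool" where
  "wf_tree (Leaf r) \<longleftrightarrow> True"
| "wf_tree (Decision ds) \<longleftrightarrow> ds \<noteq> [] \<and> distinct (map fst ds) \<and> (\<forall>(d, T)\<in>set ds. wf_tree T)"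
| "wf_tree (Chance cs) \<longleftrightarrow> partition_on UNIV (set (map fst cs)) \<and> distinct (map fst cs) \<and>
     (\<forall>(E, T)\<in>set cs. wf_tree T)"

text \<open>A tree carries an associated event \<open>ev(T)\<close>, passed below as a separate argument \<open>A\<close>.
  \<open>subtrees A T\<close> collects the pairs \<open>(ev(st\<^sub>N(T)), st\<^sub>N(T))\<close> for all nodes \<open>N\<close> of \<open>T\<close>, where
  \<open>ev(T) = A\<close>.\<close>

fun subtrees :: "'w event \<Rightarrow> ('w, 'd) dtree \<Rightarrow> ('w event \<times> ('w, 'd) dtree) set" where
  "subtrees A (Leaf r) = {(A, Leaf r)}"
| "subtrees A (Decision ds) = insert (A, Decision ds) (\<Union>(d, T)\<in>set ds. subtrees A T)"
| "subtrees A (Chance cs) = insert (A, Chance cs) (\<Union>(E, T)\<in>set cs. subtrees (A \<inter> E) T)"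

definition consistent :: "'w event \<Rightarrow> ('w, 'd) dtree \<Rightarrow> bool" where
  "consistent A T \<longleftrightarrow> (\<forall>(B, S)\<in>subtrees A T. B \<noteq> {})"

fun nfd :: "('w, 'd) dtree \<Rightarrow> ('w, 'd) dtree set" where
  "nfd (Leaf r) = {Leaf r}"
| "nfd (Decision ds) = (\<Union>(d, T)\<in>set ds. {Decision [(d, U)] |U. U \<in> nfd T})"
| "nfd (Chance cs) = {Chance us |us. list_all2 (\<lambda>(E, T) (F, U). F = E \<and> U \<in> nfd T) cs us}"

text \<open>The gamble of a normal form decision; left unspecified on trees having a decision node that
  does not have exactly one arc.\<close>

fun gamble :: "('w, 'd) dtree \<Rightarrow> 'w gamble" where
  "gamble (Leaf r) = (\<lambda>\<omega>. r)"
| "gamble (Decision [(d, U)]) = gamble U"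
| "gamble (Chance us) = (\<lambda>\<omega>. \<Sum>(E, U)\<leftarrow>us. indicator E \<omega> * gamble U \<omega>)"

definition gamb :: "('w, 'd) dtree set \<Rightarrow> 'w gamble set" where
  "gamb \<U> = (\<Union>U\<in>\<U>. {gamble U})"

definition norm_opt :: "'w choice \<Rightarrow> 'w event \<Rightarrow> ('w, 'd) dtree \<Rightarrow> ('w, 'd) dtree set" where
  "norm_opt opt A T = {U \<in> nfd T. gamb {U} \<subseteq> opt (gamb (nfd T)) A}"

fun back_opt :: "'w choice \<Rightarrow> 'w event \<Rightarrow> ('w, 'd) dtree \<Rightarrow> ('w, 'd) dtree set" where
  "back_opt opt A (Leaf r) = {Leaf r}"
| "back_opt opt A (Decision ds) =
    (let S = {U \<in> nfd (Decision ds).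
                \<exists>(d, T)\<in>set ds. \<exists>V. U = Decision [(d, V)] \<and> V \<in> back_opt opt A T}
     in {U \<in> S. gamb {U} \<subseteq> opt (gamb S) A})"
| "back_opt opt A (Chance cs) =
    (let S = {U \<in> nfd (Chance cs).
                \<exists>us. U = Chance us \<and>
                  list_all2 (\<lambda>(E, T) (F, V). F = E \<and> V \<in> back_opt opt (A \<inter> E) T) cs us}
     in {U \<in> S. gamb {U} \<subseteq> opt (gamb S) A})"

end

theory Submission
  imports Defs
begin

text \<open>For a single mass function \<open>p\<close>, the unnormalised expectation of a normal form decision at a
  chance node is the sum of those of its parts, so a decision that is optimal for \<open>p\<close> restricts to
  decisions optimal for the same \<open>p\<close>. Hence all decisions that are \<open>p\<close>-optimal in the full tree
  survive backward induction, and a surviving decision that is \<open>p\<close>-optimal among the survivors is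
  as good as one that is \<open>p\<close>-optimal in the full tree.\<close>

definition weight :: "real ^ 'w::finite \<Rightarrow> 'w event \<Rightarrow> ('w, 'd) dtree \<Rightarrow> real" where
  "weight p A U = (\<Sum>\<omega>\<in>A. gamble U \<omega> * p $ \<omega>)"

text \<open>For \<open>A = {}\<close> both sides hold, since \<open>cond_exp\<close> is then \<open>0 / 0 = 0\<close>.\<close>

lemma cond_exp_gamble_le_iff:
  assumes "\<And>\<omega>. p $ \<omega> > 0"
  shows "cond_exp p (gamble U) A \<le> cond_exp p (gamble V) A \<longleftrightarrow> weight p A U \<le> weight p A V"
proof (cases "A = {}")
  case False
  then have "(\<Sum>\<omega>\<in>A. p $ \<omega>) > 0"
    using assms by (intro sum_pos) auto
  then show ?thesis
    by (simp add: cond_exp_def weight_def divide_le_cancel)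
qed (simp add: cond_exp_def weight_def)

text \<open>Passes from gambles to the decisions themselves: from here on only \<open>weight\<close>
  has to be compared, under one witness \<open>p\<close>.\<close>

lemma gamb_subset_e_admissible_iff:
  assumes "\<And>p \<omega>. p \<in> M \<Longrightarrow> p $ \<omega> > 0" and "U \<in> S"
  shows "gamb {U} \<subseteq> e_admissible M (gamb S) A \<longleftrightarrow>
    (\<exists>p\<in>M. \<forall>V\<in>S. weight p A V \<le> weight p A U)"
  using assms by (auto simp: gamb_def e_admissible_def opt_mass_def cond_exp_gamble_le_iff)

text \<open>The recursion step shared by decision and chance nodes: \<open>N\<close> plays all
  normal form decisions, \<open>S\<close> those assembled from survivors in the subtrees.
  \<open>keep\<close> treats each \<open>p\<close> separately, so both inclusions reuse the same
  witness.\<close>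

lemma e_admissible_filter_eq:
  assumes pos: "\<And>p \<omega>. p \<in> M \<Longrightarrow> p $ \<omega> > 0"
    and sub: "S \<subseteq> N" and fin: "finite N"
    and keep: "\<And>p U. p \<in> M \<Longrightarrow> U \<in> N \<Longrightarrow> \<forall>V\<in>N. weight p A V \<le> weight p A U \<Longrightarrow> U \<in> S"
  shows "{U \<in> S. gamb {U} \<subseteq> e_admissible M (gamb S) A} =
    {U \<in> N. gamb {U} \<subseteq> e_admissible M (gamb N) A}"
proof (intro set_eqI iffI; clarify)
  fix U assume U: "U \<in> S" "gamb {U} \<subseteq> e_admissible M (gamb S) A"
  then obtain p where p: "p \<in> M" "\<forall>V\<in>S. weight p A V \<le> weight p A U"
    using gamb_subset_e_admissible_iff[OF pos] by blast
  have "Max (weight p A ` N) \<in> weight p A ` N"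
    using fin U sub by (intro Max_in) auto
  then obtain W where W: "W \<in> N" "weight p A W = Max (weight p A ` N)"
    by force
  then have W_max: "\<forall>V\<in>N. weight p A V \<le> weight p A W"
    using fin by simp
  then have "W \<in> S"
    using keep p W by blast
  then have "\<forall>V\<in>N. weight p A V \<le> weight p A U"
    using W_max p by (meson order_trans)
  then show "U \<in> N \<and> gamb {U} \<subseteq> e_admissible M (gamb N) A"
    using gamb_subset_e_admissible_iff[OF pos, of M U N] U sub p by blast
next
  fix U assume U: "U \<in> N" "gamb {U} \<subseteq> e_admissible M (gamb N) A"
  then obtain p where p: "p \<in> M" "\<forall>V\<in>N. weight p A V \<le> weight p A U"
    using gamb_subset_e_admissible_iff[OF pos] by blast
  then have "U \<in> S"
    using keep U by blast
  then show "U \<in> S \<and> gamb {U} \<subseteq> e_admissible M (gamb S) A"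
    using gamb_subset_e_admissible_iff[OF pos, of M U S] sub p by blast
qed

lemma finite_list_all2:
  assumes "\<And>x. x \<in> set xs \<Longrightarrow> finite {y. R x y}"
  shows "finite {ys. list_all2 R xs ys}"
  using assms
proof (induction xs)
  case (Cons x xs)
  have "{ys. list_all2 R (x # xs) ys} =
      (\<lambda>(y, ys). y # ys) ` ({y. R x y} \<times> {ys. list_all2 R xs ys})"
    by (auto simp: list_all2_Cons1)
  then show ?case
    using Cons by simp
qed (auto intro: finite_subset[of _ "{[]}"])

text \<open>Ensures that some decision attains the maximal weight. The rule
  \<open>wf_tree.induct\<close> serves for its case split, which gives hypotheses directly on the
  subtrees in the arc lists.\<close>

lemma finite_nfd: "finite (nfd T)"
proof (induction T rule: wf_tree.induct)
  case (2 ds)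
  have "finite {Decision [(d, U)] |U. U \<in> nfd T}" if "(d, T) \<in> set ds" for d T
    using 2 that by (auto simp: Setcompr_eq_image)
  then show ?case
    by (auto simp: case_prod_beta)
next
  case (3 cs)
  have "finite {y. (\<lambda>(F, U). F = fst x \<and> U \<in> nfd (snd x)) y}" if "x \<in> set cs" for x
  proof -
    have "{y. (\<lambda>(F, U). F = fst x \<and> U \<in> nfd (snd x)) y} = {fst x} \<times> nfd (snd x)"
      by auto
    then show ?thesis
      using 3 that by (metis finite.emptyI finite_SigmaI finite_insert prod.collapse)
  qed
  then have "finite {us. list_all2 (\<lambda>(E, T) (F, U). F = E \<and> U \<in> nfd T) cs us}"
    by (intro finite_list_all2) (simp add: case_prod_beta)
  then show ?case
    by (simp add: Setcompr_eq_image)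
qed simp

lemma weight_Decision: "weight p A (Decision [(d, U)]) = weight p A U"
  by (simp add: weight_def)

text \<open>The indicator of \<open>E\<close> cuts the sum over \<open>A\<close> down to
  \<open>A \<inter> E\<close>, exactly the event that \<open>back_opt\<close> passes to that
  branch.\<close>

lemma weight_Chance: "weight p A (Chance us) = (\<Sum>(E, U)\<leftarrow>us. weight p (A \<inter> E) U)"
proof (induction us)
  case (Cons x us)
  obtain E U where x: "x = (E, U)"
    by (cases x)
  have "(\<Sum>\<omega>\<in>A. indicator E \<omega> * gamble U \<omega> * p $ \<omega>) = weight p (A \<inter> E) U"
    unfolding weight_def by (intro sum.mono_neutral_cong_right) (auto simp: indicator_def)
  then show ?case
    using Cons by (simp add: weight_def x distrib_right sum.distrib)
qed (simp add: weight_def)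

text \<open>Exchanging one branch leaves all other summands alone, so an improvement in one branch
  would improve the whole decision.\<close>

lemma weight_Chance_update:
  assumes "i < length us"
  shows "weight p A (Chance (us[i := (E, V)])) =
    weight p A (Chance us) + weight p (A \<inter> E) V - weight p (A \<inter> fst (us ! i)) (snd (us ! i))"
proof -
  have "weight p A (Chance us) = weight p A (Chance (take i us @ us ! i # drop (Suc i) us))"
    using id_take_nth_drop[OF assms] by (rule arg_cong)
  then show ?thesis
    by (simp add: weight_Chance case_prod_beta upd_conv_take_nth_drop[OF assms])
qed

theorem back_opt_e_admissible:
  fixes M :: "(real ^ 'w::finite) set" and T :: "('w, 'd) dtree"
  assumes "M \<noteq> {}" and pos: "\<And>p \<omega>. p \<in> M \<Longrightarrow> p $ \<omega> > 0"
  shows "back_opt (e_admissible M) A T = norm_opt (e_admissible M) A T"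
proof (induction T arbitrary: A rule: wf_tree.induct)
  case (1 r)
  then show ?case
    \<comment> \<open>\<open>back_opt\<close> keeps a leaf without consulting the choice function;
      \<open>norm_opt\<close> keeps it because any member of \<open>M\<close> makes the only option
      optimal.\<close>
    using gamb_subset_e_admissible_iff[OF pos, of M "Leaf r" "{Leaf r}"] \<open>M \<noteq> {}\<close>
    by (auto simp: norm_opt_def)
next
  case (2 ds)
  have keep: "\<exists>(d, T)\<in>set ds. \<exists>V. U = Decision [(d, V)] \<and> V \<in> back_opt (e_admissible M) A T"
    if p: "p \<in> M" and U: "U \<in> nfd (Decision ds)"
      and max: "\<forall>V\<in>nfd (Decision ds). weight p A V \<le> weight p A U" for p U
  proof -
    obtain d T V where V: "(d, T) \<in> set ds" "U = Decision [(d, V)]" "V \<in> nfd T"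
      using U by auto
    have "weight p A W \<le> weight p A V" if "W \<in> nfd T" for W
    proof -
      \<comment> \<open>Put behind the same arc \<open>d\<close>, the rival \<open>W\<close> of
        \<open>V\<close> becomes a rival of \<open>U\<close> of unchanged weight.\<close>
      have "Decision [(d, W)] \<in> nfd (Decision ds)"
        using V(1) that by auto
      then show ?thesis
        using max V(2) by (metis weight_Decision)
    qed
    then have "V \<in> norm_opt (e_admissible M) A T"
      using gamb_subset_e_admissible_iff[OF pos, of M V "nfd T"] p V by (auto simp: norm_opt_def)
    then show ?thesis
      using 2 V(1,2) by blast
  qed
  show ?case
    unfolding back_opt.simps Let_def norm_opt_def
    by (intro e_admissible_filter_eq finite_nfd pos) (use keep in auto)
next
  case (3 cs)
  have keep: "\<exists>us. U = Chance us \<and>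
      list_all2 (\<lambda>(E, T) (F, V). F = E \<and> V \<in> back_opt (e_admissible M) (A \<inter> E) T) cs us"
    if p: "p \<in> M" and U: "U \<in> nfd (Chance cs)"
      and max: "\<forall>V\<in>nfd (Chance cs). weight p A V \<le> weight p A U" for p U
  proof -
    let ?R = "\<lambda>(E, T) (F, U). F = E \<and> U \<in> nfd T"
    obtain us where us: "U = Chance us" "list_all2 ?R cs us"
      using U by auto
    have len: "length us = length cs"
      using us(2) by (simp add: list_all2_lengthD)
    have part: "snd (us ! i) \<in> back_opt (e_admissible M) (A \<inter> E) T \<and> fst (us ! i) = E"
      if i: "i < length cs" and ET: "cs ! i = (E, T)" for i E T
    proof -
      have ui: "fst (us ! i) = E" "snd (us ! i) \<in> nfd T"
        using us(2) i ET by (auto dest!: list_all2_nthD simp: case_prod_beta)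
      have "weight p (A \<inter> E) V \<le> weight p (A \<inter> E) (snd (us ! i))" if V: "V \<in> nfd T" for V
      proof -
        \<comment> \<open>The trivial update of \<open>cs\<close> lets both lists be updated in
          parallel: swapping in \<open>V\<close> at branch \<open>i\<close> gives a rival of
          \<open>U\<close>.\<close>
        have "list_all2 ?R (cs[i := cs ! i]) (us[i := (E, V)])"
          using us(2) ET V by (intro list_all2_update_cong) auto
        then have "Chance (us[i := (E, V)]) \<in> nfd (Chance cs)"
          by simp
        then show ?thesis
          using max us(1) weight_Chance_update[of i us p A E V] i len ui by auto
      qed
      then have "snd (us ! i) \<in> norm_opt (e_admissible M) (A \<inter> E) T"
        using gamb_subset_e_admissible_iff[OF pos, of M "snd (us ! i)" "nfd T"] p ui
        by (auto simp: norm_opt_def)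
      then show ?thesis
        \<comment> \<open>The induction hypothesis, at the event \<open>A \<inter> E\<close>, turns
          \<open>norm_opt\<close> into \<open>back_opt\<close>.\<close>
        using 3 i ET ui by (metis nth_mem)
    qed
    show ?thesis
      using us(1) len part[OF _ surjective_pairing]
      by (simp add: list_all2_conv_all_nth case_prod_beta)
  qed
  show ?case
    unfolding back_opt.simps Let_def norm_opt_def
    by (intro e_admissible_filter_eq finite_nfd pos) (use keep in blast)+
qed

theorem corollary19:
  fixes M :: "(real ^ 'w::finite) set"
    and A :: "'w event"
    and T :: "('w, 'd) dtree"
  assumes "credal_set M"
    and "wf_tree T"
    and "consistent A T"
  shows "back_opt (e_admissible M) A T = norm_opt (e_admissible M) A T"
  using assms(1) by (intro back_opt_e_admissible) (auto simp: credal_set_def)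

end
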